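(* Let $G=(V,E)$ be a complete graph with metric costs $c$. Suppose that: (1) the unique optimal solution to $\mathrm{2ECM\text{-}IP}$ on $(G,c)$ is (the incidence vector of) a Hamiltonian cycle $T$; and (2) $\mathrm{2ECM\text{-}LP}$ on $(G,c)$ admits a half-integral optimal solution. Then the TSP integrality gap on this instance is at most $\tfrac43$, i.e. \[\mathrm{OPT}_{\mathrm{TSP\text{-}IP}}\le\tfrac43\,\mathrm{OPT}_{\mathrm{TSP\text{-}LP}}.\]
   Context: Metric costs: $c$ assigns to each edge $ij$ a nonnegative symmetric cost $c_{ij}=c_{ji}\ge 0$ with $c_{ij}\le c_{ik}+c_{kj}$ for all $i,j,k\in V$. For $S\subset V$, $\delta(S)$ is the set of edges with exactly one endpoint in $S$, $\delta(v)=\delta(\{v\})$, and $x(F)=\sum_{e\in F}x_e$. The four problems all minimize $\sum_{e\in E}c_ex_e$: - $\mathrm{TSP\text{-}IP}$: over incidence vectors of Hamiltonian cycles on $V$. - $\mathrm{TSP\text{-}LP}$: subject to $x(\delta(v))=2$ for all $v\in V$; $x(\delta(S))\ge 2$ for all $\emptyset\ne S\subsetneq V$; $0\le x_e\le 1$ for all $e\in E$. - $\mathrm{2ECM\text{-}IP}$ (2-edge-connected spanning multisubgraph problem): subject to $x(\delta(S))\ge 2$ for all $\emptyset\neq S\subsetneq V$; $x_e\ge 0$; $x_e\in\mathbb{Z}$ for all $e\in E$ ($x_e$ is the multiplicity of $e$). - $\mathrm{2ECM\text{-}LP}$: the constraints of $\mathrm{2ECM\text{-}IP}$ without integrality, together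 with $x(\delta(v))=2$ for all $v\in V$. $\mathrm{OPT}_X$ denotes the optimal objective value of problem $X$ on the given instance. A solution $x$ is half-integral if $x_e\in\{0,\tfrac12,1\}$ for all $e\in E$. *)

theory Defs
  imports "HOL-Library.Indicator_Function"
begin

definition complete_edges :: "'a set \<Rightarrow> 'a set set" where
  "complete_edges V = {e. e \<subseteq> V \<and> card e = 2}"

definition cut :: "'a set \<Rightarrow> 'a set \<Rightarrow> 'a set set" where
  "cut V S = {e \<in> complete_edges V. card (e \<inter> S) = 1}"

(* Costs live on unordered pairs, so symmetry is built in. There are no loops, hence the
   triangle inequality is stated for distinct i, j, k; this is what the inequality for all
   i, j, k amounts to under the usual convention that the diagonal costs are 0. *)
definition metric_costs :: "'a set \<Rightarrow> ('a set \<Rightarrow> real) \<Rightarrow> bool" where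
  "metric_costs V c \<longleftrightarrow>
     (\<forall>e \<in> complete_edges V. 0 \<le> c e) \<and>
     (\<forall>i\<in>V. \<forall>j\<in>V. \<forall>k\<in>V. i \<noteq> j \<longrightarrow> i \<noteq> k \<longrightarrow> j \<noteq> k \<longrightarrow>
        c {i, j} \<le> c {i, k} + c {k, j})"

(* The edge set of a cycle through all vertices. A cycle has at least three vertices, so a
   doubled edge on two vertices is not a Hamiltonian cycle. *)
definition hamiltonian_cycle :: "'a set \<Rightarrow> 'a set set \<Rightarrow> bool" where
  "hamiltonian_cycle V T \<longleftrightarrow>
     (\<exists>vs. distinct vs \<and> set vs = V \<and> length vs \<ge> 3 \<and>
        T = {{vs ! i, vs ! (Suc i mod length vs)} | i. i < length vs})"

(* Vectors indexed by the edges are represented as functions vanishing off the edge set, so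
   that equality of functions is equality of vectors; this matters for uniqueness. *)
definition edge_vectors :: "'a set \<Rightarrow> ('a set \<Rightarrow> real) set" where
  "edge_vectors V = {x. \<forall>e. e \<notin> complete_edges V \<longrightarrow> x e = 0}"

definition objective :: "'a set \<Rightarrow> ('a set \<Rightarrow> real) \<Rightarrow> ('a set \<Rightarrow> real) \<Rightarrow> real" where
  "objective V c x = (\<Sum>e \<in> complete_edges V. c e * x e)"

(* Each problem is given by its set of feasible vectors; the incidence vector of an edge set T
   is indicator T. *)

definition tsp_ip :: "'a set \<Rightarrow> ('a set \<Rightarrow> real) set" where
  "tsp_ip V = {indicator T | T. hamiltonian_cycle V T}"

definition tsp_lp :: "'a set \<Rightarrow> ('a set \<Rightarrow> real) set" where
  "tsp_lp V = {x \<in> edge_vectors V.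
     (\<forall>v\<in>V. sum x (cut V {v}) = 2) \<and>
     (\<forall>S. S \<noteq> {} \<and> S \<subset> V \<longrightarrow> sum x (cut V S) \<ge> 2) \<and>
     (\<forall>e \<in> complete_edges V. 0 \<le> x e \<and> x e \<le> 1)}"

definition two_ecm_ip :: "'a set \<Rightarrow> ('a set \<Rightarrow> real) set" where
  "two_ecm_ip V = {x \<in> edge_vectors V.
     (\<forall>S. S \<noteq> {} \<and> S \<subset> V \<longrightarrow> sum x (cut V S) \<ge> 2) \<and>
     (\<forall>e \<in> complete_edges V. 0 \<le> x e) \<and>
     (\<forall>e \<in> complete_edges V. x e \<in> \<int>)}"

definition two_ecm_lp :: "'a set \<Rightarrow> ('a set \<Rightarrow> real) set" where
  "two_ecm_lp V = {x \<in> edge_vectors V.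
     (\<forall>v\<in>V. sum x (cut V {v}) = 2) \<and>
     (\<forall>S. S \<noteq> {} \<and> S \<subset> V \<longrightarrow> sum x (cut V S) \<ge> 2) \<and>
     (\<forall>e \<in> complete_edges V. 0 \<le> x e)}"

definition optimal_solution ::
  "'a set \<Rightarrow> ('a set \<Rightarrow> real) \<Rightarrow> ('a set \<Rightarrow> real) set \<Rightarrow> ('a set \<Rightarrow> real) \<Rightarrow> bool" where
  "optimal_solution V c F x \<longleftrightarrow> is_arg_min (objective V c) (\<lambda>y. y \<in> F) x"

(* As an infimum of reals this is meaningful only when F is nonempty and the objective is
   bounded below on F. For nonnegative costs and a finite V with at least three vertices, both
   hold for all four problems above. *)
definition opt_value :: "'a set \<Rightarrow> ('a set \<Rightarrow> real) \<Rightarrow> ('a set \<Rightarrow> real) set \<Rightarrow> real" where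
  "opt_value V c F = (INF x \<in> F. objective V c x)"

definition half_integral :: "'a set \<Rightarrow> ('a set \<Rightarrow> real) \<Rightarrow> bool" where
  "half_integral V x \<longleftrightarrow> (\<forall>e \<in> complete_edges V. x e \<in> {0, 1/2, 1})"

end

theory Submission
  imports Defs
begin

text \<open>If \<open>x\<close> is half-integral, then \<open>2 x\<close> is a 4-regular, 4-edge-connected multigraph, so it suffices
  to find in such a graph, for some edge \<open>e\<close>, a 2-edge-connected spanning subgraph avoiding \<open>e\<close>
  of cost at most 2/3 of the cost of the edges other than \<open>e\<close> (Carr and Ravi). This holds for every
  \<open>e\<close> and arbitrary real costs, by induction on the number of vertices. Let \<open>e, a, b, c\<close> be the edges
  at an end \<open>v\<close> of \<open>e\<close>. By parity and uncrossing, at least two of the three ways of pairing them up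
  and splitting off \<open>v\<close> preserve 4-edge-connectivity, say those that pair \<open>e\<close> with \<open>a\<close> and \<open>e\<close> with \<open>b\<close>.
  In both split graphs a subgraph avoiding the edge made from \<open>e\<close> lifts: either it uses the other
  new edge, which is replaced by its two halves, or \<open>v\<close> is attached by \<open>a\<close> and \<open>b\<close>. If the other new
  edge is given the difference of these two costs, then the average of the two resulting bounds is the
  bound sought.\<close>

section \<open>Cuts in 4-regular, 4-edge-connected multigraphs\<close>

definition crossing :: "('e \<Rightarrow> 'v set) \<Rightarrow> 'e set \<Rightarrow> 'v set \<Rightarrow> 'e set" where
  "crossing ends E S = {e \<in> E. ends e \<inter> S \<noteq> {} \<and> \<not> ends e \<subseteq> S}"

lemma finite_crossing [simp]: "finite E \<Longrightarrow> finite (crossing ends E S)"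
  by (simp add: crossing_def)

lemma card_crossing_sum:
  "finite E \<Longrightarrow>
    card (crossing ends E S) = (\<Sum>e\<in>E. of_bool (ends e \<inter> S \<noteq> {} \<and> \<not> ends e \<subseteq> S))"
  by (simp add: crossing_def Int_def)

lemma card_crossing_insert:
  assumes "finite E" "e \<notin> E"
  shows "card (crossing ends (insert e E) S) =
    of_bool (ends e \<inter> S \<noteq> {} \<and> \<not> ends e \<subseteq> S) + card (crossing ends E S)"
  using assms by (simp add: card_crossing_sum del: sum_of_bool_eq)

text \<open>Edges are names carrying an end map, so parallel edges stay distinct; end sets of size 2
  exclude loops.\<close>

locale quartic_graph =
  fixes V :: "'v set" and E :: "'e set" and ends :: "'e \<Rightarrow> 'v set"
  assumes finite_vertices: "finite V"
    and finite_edges: "finite E"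
    and ends_subset: "e \<in> E \<Longrightarrow> ends e \<subseteq> V"
    and card_ends: "e \<in> E \<Longrightarrow> card (ends e) = 2"
    and degree: "v \<in> V \<Longrightarrow> card (crossing ends E {v}) = 4"
    and cut_ge_4: "S \<noteq> {} \<Longrightarrow> S \<subset> V \<Longrightarrow> 4 \<le> card (crossing ends E S)"
begin

lemma ends_cases:
  assumes "e \<in> E"
  obtains x y where "ends e = {x, y}" "x \<noteq> y" "x \<in> V" "y \<in> V"
  using card_ends[OF assms] ends_subset[OF assms] by (auto simp: card_2_iff)

lemma ends_crossing_singleton:
  assumes "e \<in> crossing ends E {v}"
  shows "\<exists>x. ends e = {v, x}"
proof -
  have "e \<in> E" "v \<in> ends e" using assms by (auto simp: crossing_def)
  then show ?thesis by (metis ends_cases insert_iff insert_commute singletonD)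
qed

text \<open>Adding a vertex \<open>w\<close> to \<open>S\<close> replaces the cut by its symmetric
  difference with the star of \<open>w\<close>, which has four edges, so parity is
  preserved.\<close>

lemma even_card_crossing:
  assumes "S \<subseteq> V"
  shows "even (card (crossing ends E S))"
proof -
  have "finite S" using assms finite_vertices finite_subset by blast
  then show ?thesis using assms
  proof (induction S)
    case empty
    then show ?case by (simp add: crossing_def)
  next
    case (insert w S)
    let ?A = "crossing ends E S" and ?B = "crossing ends E {w}"
    have eq: "crossing ends E (insert w S) = (?A - ?B) \<union> (?B - ?A)"
    proof (intro set_eqI)
      fix e
      show "e \<in> crossing ends E (insert w S) \<longleftrightarrow> e \<in> (?A - ?B) \<union> (?B - ?A)"
      proof (cases "e \<in> E")
        case True
        then obtain x y where "ends e = {x, y}" "x \<noteq> y" by (rule ends_cases)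
        then show ?thesis using insert.hyps by (auto simp: crossing_def)
      qed (simp add: crossing_def)
    qed
    have fin: "finite ?A" "finite ?B" using finite_edges by auto
    have "card (crossing ends E (insert w S)) = card (?A - ?B) + card (?B - ?A)"
      unfolding eq using fin by (intro card_Un_disjoint) auto
    moreover have "card ?A = card (?A - ?B) + card (?A \<inter> ?B)"
      using fin by (metis card_Diff_subset_Int card_mono Int_lower1 finite_Int le_add_diff_inverse2)
    moreover have "card ?B = card (?B - ?A) + card (?A \<inter> ?B)"
      using fin by (metis card_Diff_subset_Int card_mono Int_lower1 Int_commute finite_Int
          le_add_diff_inverse2)
    moreover have "even (card ?A)" "card ?B = 4"
      using insert degree by auto
    moreover have "even n" if "n = i + j" "m = i + k" "4 = j + k" "even m" for n m i j k :: nat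
      using that by presburger
    ultimately show ?case by metis
  qed
qed

text \<open>Every edge counts on the left at most as often as on the right (posimodularity). The
  edge \<open>e\<close> joins the intersection of \<open>A\<close> and \<open>B\<close> to a vertex
  outside both, so it counts twice on the right and not at all on the left.\<close>

lemma uncrossing:
  assumes "e \<in> E" "ends e = {v, x}" "v \<notin> A" "v \<notin> B" "x \<in> A" "x \<in> B"
  shows "card (crossing ends E (A - B)) + card (crossing ends E (B - A)) + 2
    \<le> card (crossing ends E A) + card (crossing ends E B)"
proof -
  define X where "X S f = (of_bool (ends f \<inter> S \<noteq> {} \<and> \<not> ends f \<subseteq> S) :: nat)" for S f
  have card: "card (crossing ends E S) = X S e + (\<Sum>f\<in>E - {e}. X S f)" for S
    unfolding card_crossing_sum[OF finite_edges] X_def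
    by (rule sum.remove[OF finite_edges assms(1)])
  have "X (A - B) f + X (B - A) f \<le> X A f + X B f" if f: "f \<in> E" for f
  proof -
    obtain x y where "ends f = {x, y}" using f by (rule ends_cases)
    then show ?thesis by (auto simp: X_def)
  qed
  then have "(\<Sum>f\<in>E - {e}. X (A - B) f) + (\<Sum>f\<in>E - {e}. X (B - A) f)
      \<le> (\<Sum>f\<in>E - {e}. X A f) + (\<Sum>f\<in>E - {e}. X B f)"
    unfolding sum.distrib[symmetric] by (intro sum_mono) auto
  moreover have "X (A - B) e = 0" "X (B - A) e = 0" "X A e = 1" "X B e = 1"
    using assms by (auto simp: X_def)
  ultimately show ?thesis unfolding card by linarith
qed

end

section \<open>Splitting off a vertex\<close>

definition split_ends :: "('e \<Rightarrow> 'v set) \<Rightarrow> 'v \<Rightarrow> 'e \<Rightarrow> 'e \<Rightarrow> 'e \<Rightarrow> 'e \<Rightarrow> 'e \<Rightarrow> 'v set" where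
  "split_ends ends v p q r s =
     ends(p := (ends p \<union> ends q) - {v}, r := (ends r \<union> ends s) - {v})"

text \<open>Vertex \<open>v\<close> is split off: \<open>p\<close> takes the place of the path \<open>p, q\<close> through \<open>v\<close>, and \<open>r\<close> that
  of \<open>r, s\<close>; reusing the names \<open>p\<close> and \<open>r\<close> keeps the edge type fixed.\<close>

abbreviation splittable where
  "splittable V E ends v p q r s \<equiv>
     quartic_graph (V - {v}) (E - {q, s}) (split_ends ends v p q r s)"

context quartic_graph
begin

context
  fixes v p q r s P Q R Z
  assumes v: "v \<in> V"
    and star: "crossing ends E {v} = {p, q, r, s}" "distinct [p, q, r, s]"
    and endv: "ends p = {v, P}" "ends q = {v, Q}" "ends r = {v, R}" "ends s = {v, Z}"
begin

lemma star_edges: "p \<in> E" "q \<in> E" "r \<in> E" "s \<in> E"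
  using star(1) unfolding crossing_def by blast+

lemma other_ends:
  "P \<in> V" "Q \<in> V" "R \<in> V" "Z \<in> V" "P \<noteq> v" "Q \<noteq> v" "R \<noteq> v" "Z \<noteq> v"
  using star_edges[THEN ends_subset] star_edges[THEN card_ends] endv by auto

lemma ends_off_star:
  assumes "e \<in> E - {p, q, r, s}"
  shows "v \<notin> ends e"
proof
  assume "v \<in> ends e"
  moreover obtain x y where "ends e = {x, y}" "x \<noteq> y" using assms ends_cases by blast
  ultimately have "e \<in> crossing ends E {v}" using assms by (auto simp: crossing_def)
  then show False using assms star by auto
qed

text \<open>This count and the next one are both relative to the edges off the star of
  \<open>v\<close>, so that cuts before and after splitting can be compared term by term.\<close>

lemma card_crossing_star:
  assumes "S \<subseteq> V - {v}"
  shows "card (crossing ends E S) = card (crossing ends (E - {p, q, r, s}) S)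
    + of_bool (P \<in> S) + of_bool (Q \<in> S) + of_bool (R \<in> S) + of_bool (Z \<in> S)"
proof -
  let ?K = "E - {p, q, r, s}"
  have "E = insert p (insert q (insert r (insert s ?K)))"
    using star_edges by auto
  moreover have "card (crossing ends (insert p (insert q (insert r (insert s ?K)))) S) =
    card (crossing ends ?K S)
    + of_bool (P \<in> S) + of_bool (Q \<in> S) + of_bool (R \<in> S) + of_bool (Z \<in> S)"
    using assms finite_edges star(2) by (simp add: card_crossing_insert endv) auto
  ultimately show ?thesis by simp
qed

lemma card_crossing_split:
  "card (crossing (split_ends ends v p q r s) (E - {q, s}) S) =
    card (crossing ends (E - {p, q, r, s}) S)
    + of_bool ((P \<in> S) \<noteq> (Q \<in> S)) + of_bool ((R \<in> S) \<noteq> (Z \<in> S))"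
proof -
  let ?K = "E - {p, q, r, s}"
  have "E - {q, s} = insert p (insert r ?K)"
    using star_edges star(2) by auto
  moreover have "split_ends ends v p q r s p = {P, Q}" "split_ends ends v p q r s r = {R, Z}"
    using star(2) other_ends by (auto simp: split_ends_def endv)
  moreover have "crossing (split_ends ends v p q r s) ?K S = crossing ends ?K S"
    by (auto simp: crossing_def split_ends_def)
  moreover have "p \<notin> insert r ?K" "r \<notin> ?K" using star(2) by auto
  ultimately show ?thesis using finite_edges by (auto simp: card_crossing_insert)
qed

text \<open>Edges off the star avoid \<open>v\<close>. The complement of \<open>S\<close> thus
  yields a second lower bound on the same set of edges, with the neighbours of \<open>v\<close>
  inside and outside \<open>S\<close> exchanged.\<close>

lemma crossing_complement:
  assumes "S \<subseteq> V - {v}"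
  shows "crossing ends (E - {p, q, r, s}) (V - {v} - S) = crossing ends (E - {p, q, r, s}) S"
proof (intro set_eqI)
  fix e
  show "e \<in> crossing ends (E - {p, q, r, s}) (V - {v} - S)
    \<longleftrightarrow> e \<in> crossing ends (E - {p, q, r, s}) S"
  proof (cases "e \<in> E - {p, q, r, s}")
    case True
    then have "ends e \<subseteq> V - {v}" using ends_off_star ends_subset by blast
    then show ?thesis using assms by (auto simp: crossing_def)
  qed (auto simp: crossing_def)
qed

text \<open>Splitting lowers the cut of \<open>S\<close> by 2 for each pair with both far ends in
  \<open>S\<close>. If three or four far ends lie in \<open>S\<close>, the cut of the complement is
  already large enough. So only a set separating the two pairs can fail, and by parity only if its
  cut is exactly 4.\<close>

lemma tight_set_if_not_splittable:
  assumes "3 \<le> card V" and "\<not> splittable V E ends v p q r s"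
  shows "\<exists>S \<subseteq> V - {v}. P \<in> S \<and> Q \<in> S \<and> R \<notin> S \<and> Z \<notin> S \<and> card (crossing ends E S) = 4"
proof (rule ccontr)
  let ?ends = "split_ends ends v p q r s" and ?E = "E - {q, s}"
  assume not4: "\<not> ?thesis"
  have ge6: "6 \<le> card (crossing ends E S)"
    if "S \<subseteq> V - {v}" "P \<in> S" "Q \<in> S" "R \<notin> S" "Z \<notin> S" for S
  proof -
    have "4 \<le> card (crossing ends E S)" using cut_ge_4[of S] that v by blast
    moreover have "even (card (crossing ends E S))" using even_card_crossing that by blast
    moreover have "card (crossing ends E S) \<noteq> 4" using not4 that by blast
    moreover have "6 \<le> n" if "4 \<le> n" "even n" "n \<noteq> 4" for n :: nat
      using that by presburger
    ultimately show ?thesis by blast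
  qed
  have cut': "4 \<le> card (crossing ?ends ?E S)" if S: "S \<noteq> {}" "S \<subset> V - {v}" for S
  proof -
    let ?C = "V - {v} - S"
    have sub: "S \<subseteq> V - {v}" "?C \<subseteq> V - {v}" using S by auto
    have mem: "P \<in> ?C \<longleftrightarrow> P \<notin> S" "Q \<in> ?C \<longleftrightarrow> Q \<notin> S" "R \<in> ?C \<longleftrightarrow> R \<notin> S" "Z \<in> ?C \<longleftrightarrow> Z \<notin> S"
      using other_ends by auto
    have "4 \<le> card (crossing ends E S)" "4 \<le> card (crossing ends E ?C)"
      using cut_ge_4[of S] cut_ge_4[of ?C] S v by blast+
    moreover note ge6[OF sub(1)] ge6[OF sub(2)]
    ultimately show ?thesis
      unfolding card_crossing_split card_crossing_star[OF sub(1)] card_crossing_star[OF sub(2)]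
        crossing_complement[OF sub(1)] mem
      by (cases "P \<in> S"; cases "Q \<in> S"; cases "R \<in> S"; cases "Z \<in> S") simp_all
  qed
  have cut_singleton: "4 \<le> card (crossing ?ends ?E {w})" if "w \<in> V - {v}" for w
  proof (rule cut')
    have "V - {v} \<noteq> {w}"
    proof
      assume "V - {v} = {w}"
      then have "V = {v, w}" using v by auto
      then have "card V \<le> 2" by (simp add: card_insert_if)
      then show False using assms(1) by simp
    qed
    then show "{w} \<subset> V - {v}" using that by blast
  qed simp
  have deg: "card (crossing ends (E - {p, q, r, s}) {w})
    + of_bool (P = w) + of_bool (Q = w) + of_bool (R = w) + of_bool (Z = w) = 4"
    if "w \<in> V - {v}" for w
    using card_crossing_star[of "{w}"] degree[of w] that by simp
  \<comment> \<open>A loop at \<open>P\<close> would leave at most 2 edges in the cut of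
    \<open>{P}\<close> in the split graph.\<close>
  have PQ: "P \<noteq> Q"
    using cut_singleton[of P] deg[of P] other_ends unfolding card_crossing_split
    by (cases "R = P"; cases "Z = P") auto
  have RZ: "R \<noteq> Z"
    using cut_singleton[of R] deg[of R] other_ends unfolding card_crossing_split
    by (cases "P = R"; cases "Q = R") auto
  have ends': "?ends p = {P, Q}" "?ends r = {R, Z}"
    "\<And>e. e \<noteq> p \<Longrightarrow> e \<noteq> r \<Longrightarrow> ?ends e = ends e"
    using star(2) other_ends by (auto simp: split_ends_def endv)
  have "splittable V E ends v p q r s"
  proof
    show "finite (V - {v})" "finite ?E" using finite_vertices finite_edges by auto
    show "?ends e \<subseteq> V - {v}" if "e \<in> ?E" for e
      using that ends' other_ends ends_off_star[of e] ends_subset[of e]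
      by (cases "e = p"; cases "e = r") auto
    show "card (?ends e) = 2" if "e \<in> ?E" for e
      using that ends' PQ RZ card_ends[of e] by (cases "e = p"; cases "e = r") auto
    \<comment> \<open>Splitting never enlarges the cut of \<open>{w}\<close>, so the old degree is
      an upper bound, and \<open>cut_singleton\<close> is the matching lower bound.\<close>
    show "card (crossing ?ends ?E {w}) = 4" if "w \<in> V - {v}" for w
      using cut_singleton[OF that] deg[OF that] unfolding card_crossing_split
      by (cases "P = w"; cases "Q = w"; cases "R = w"; cases "Z = w") simp_all
  qed (use cut' in auto)
  then show False using assms(2) by simp
qed

end

text \<open>The two conjuncts of a disjunct are the same graph, with either name for the second new
  edge. If both pairings fail, there are tight sets \<open>A\<close> containing \<open>P\<close>,
  \<open>Q\<close> and \<open>B\<close> containing \<open>P\<close>, \<open>R\<close>. Uncrossing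
  them along \<open>p\<close> leaves at most 6 for the cuts of \<open>A - B\<close> and
  \<open>B - A\<close>, which contain \<open>Q\<close> and \<open>R\<close> respectively and so have
  cuts of at least 4 each.\<close>

lemma splittable_or_splittable:
  assumes "3 \<le> card V" "v \<in> V"
    and star: "crossing ends E {v} = {p, q, r, s}" "distinct [p, q, r, s]"
  shows "splittable V E ends v p q r s \<and> splittable V E ends v p q s r
    \<or> splittable V E ends v p r q s \<and> splittable V E ends v p r s q"
proof (rule ccontr)
  assume neg: "\<not> ?thesis"
  have "\<exists>x. ends e = {v, x}" if "e \<in> {p, q, r, s}" for e
    using that star(1) ends_crossing_singleton by blast
  then obtain P Q R Z where
    endv: "ends p = {v, P}" "ends q = {v, Q}" "ends r = {v, R}" "ends s = {v, Z}"
    by (metis insertCI)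
  have tight: "\<exists>S \<subseteq> V - {v}. P \<in> S \<and> Q \<in> S \<and> R \<notin> S \<and> Z \<notin> S
      \<and> card (crossing ends E S) = 4"
    if "crossing ends E {v} = {p, q, r, s}" "distinct [p, q, r, s]"
      "ends q = {v, Q}" "ends r = {v, R}" "ends s = {v, Z}"
      "\<not> splittable V E ends v p q r s" for q r s Q R Z
    using tight_set_if_not_splittable[OF assms(2) that(1,2) endv(1) that(3-5) assms(1) that(6)] .
  have perms: "{p, q, s, r} = {p, q, r, s}" "{p, r, q, s} = {p, q, r, s}"
    "{p, r, s, q} = {p, q, r, s}" by auto
  obtain A where A: "A \<subseteq> V - {v}" "P \<in> A" "Q \<in> A" "R \<notin> A" "Z \<notin> A"
      "card (crossing ends E A) = 4"
    using tight[of q r s Q R Z] tight[of q s r Q Z R] neg star endv by (auto simp: perms)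
  obtain B where B: "B \<subseteq> V - {v}" "P \<in> B" "R \<in> B" "Q \<notin> B" "Z \<notin> B"
      "card (crossing ends E B) = 4"
    using tight[of r q s R Q Z] tight[of r s q R Z Q] neg star endv by (auto simp: perms)
  have "p \<in> E" using star(1) by (auto simp: crossing_def)
  then have "card (crossing ends E (A - B)) + card (crossing ends E (B - A)) + 2 \<le> 8"
    using uncrossing[of p v P A B] A B endv by auto
  moreover have "4 \<le> card (crossing ends E (A - B))" "4 \<le> card (crossing ends E (B - A))"
    using A B assms(2) by (intro cut_ge_4; blast)+
  ultimately show False by linarith
qed

end

section \<open>Lifting subgraphs through a split, and the induction\<close>

definition two_edge_connected :: "'v set \<Rightarrow> ('e \<Rightarrow> 'v set) \<Rightarrow> 'e set \<Rightarrow> bool" where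
  "two_edge_connected V ends H \<longleftrightarrow>
     (\<forall>S. S \<noteq> {} \<longrightarrow> S \<subset> V \<longrightarrow> 2 \<le> card (crossing ends H S))"

context quartic_graph
begin

text \<open>In the split graph \<open>b\<close> names the path \<open>b\<close>, \<open>c\<close>.
  If \<open>b\<close> is in \<open>H\<close>, adding \<open>c\<close> restores that path; otherwise
  \<open>v\<close> is attached by \<open>a\<close> and \<open>b\<close>. When the new edge crosses a
  set avoiding \<open>v\<close>, exactly one of \<open>B\<close>, \<open>C\<close> is inside, so one
  of \<open>b\<close>, \<open>c\<close> crosses it too.\<close>

lemma two_edge_connected_lift:
  assumes v: "v \<in> V"
    and star: "crossing ends E {v} = {e, a, b, c}" "distinct [e, a, b, c]"
    and endv: "ends e = {v, X}" "ends a = {v, A}" "ends b = {v, B}" "ends c = {v, C}"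
    and H: "H \<subseteq> E - {a, c} - {e}"
      "two_edge_connected (V - {v}) (split_ends ends v e a b c) H"
  shows "two_edge_connected V ends (if b \<in> H then insert c H else insert a (insert b H))"
proof -
  let ?ends = "split_ends ends v e a b c"
  let ?L = "if b \<in> H then insert c H else insert a (insert b H)"
  note other = other_ends[OF v star endv]
  have finH: "finite H" using H(1) finite_edges finite_subset by blast
  have ends': "?ends b = {B, C}" "\<And>f. f \<noteq> e \<Longrightarrow> f \<noteq> b \<Longrightarrow> ?ends f = ends f"
    using star(2) other by (auto simp: split_ends_def endv)
  define K where "K = H - {b}"
  have K: "K \<subseteq> E - {e, a, b, c}" "finite K" using H(1) finH by (auto simp: K_def)
  have H_eq: "H = (if b \<in> H then insert b K else K)" by (auto simp: K_def)
  have L_eq: "?L = (if b \<in> H then insert b (insert c K) else insert a (insert b K))"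
    by (auto simp: K_def)
  have K': "crossing ?ends K S = crossing ends K S" for S
  proof -
    have "?ends f = ends f" if "f \<in> K" for f using that K by (intro ends') auto
    then show ?thesis unfolding crossing_def by auto
  qed
  have notin: "a \<notin> K" "b \<notin> K" "c \<notin> K" "a \<noteq> b" "b \<noteq> c" using K star(2) by auto
  \<comment> \<open>Sets avoiding \<open>v\<close> suffice, by complementation. Among them
    \<open>V - {v}\<close> is not a proper subset in the split graph; it is crossed by the two edges
    of the lift at \<open>v\<close>.\<close>
  have main: "2 \<le> card (crossing ends ?L S)" if S: "S \<noteq> {}" "S \<subseteq> V - {v}" for S
  proof (cases "S = V - {v}")
    case True
    then show ?thesis
      unfolding L_eq using K notin other by (simp add: card_crossing_insert endv)
  next
    case False
    then have "2 \<le> card (crossing ?ends H S)"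
      using H(2) S unfolding two_edge_connected_def by blast
    moreover have "v \<notin> S" using S by auto
    ultimately show ?thesis
      unfolding L_eq using K notin
      by (subst (asm) H_eq)
        (auto simp: card_crossing_insert endv ends' K' split: if_splits)
  qed
  have L_sub: "?L \<subseteq> E" using H(1) star_edges[OF v star endv] by auto
  show ?thesis unfolding two_edge_connected_def
  proof (intro allI impI)
    fix S assume S: "S \<noteq> {}" "S \<subset> V"
    show "2 \<le> card (crossing ends ?L S)"
    proof (cases "v \<in> S")
      case False
      then show ?thesis using main[of S] S by blast
    next
      case True
      have "f \<in> crossing ends ?L (V - S) \<longleftrightarrow> f \<in> crossing ends ?L S" for f
      proof (cases "f \<in> ?L")
        case True
        then have "ends f \<subseteq> V" using L_sub ends_subset by blast
        then show ?thesis using S by (auto simp: crossing_def)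
      qed (simp add: crossing_def)
      then have "crossing ends ?L (V - S) = crossing ends ?L S" by blast
      moreover have "2 \<le> card (crossing ends ?L (V - S))" using S True by (intro main) auto
      ultimately show ?thesis by (simp only:)
    qed
  qed
qed

end

text \<open>Stated apart from the induction so that \<open>a\<close>, \<open>b\<close>,
  \<open>c\<close> can be permuted. \<open>IH\<close> ranges over all weights because each split
  graph receives a modified weight function, possibly with negative values.\<close>

lemma quartic_graph_split_step:
  fixes w :: "'e \<Rightarrow> real"
  assumes G: "quartic_graph V E ends" and v: "v \<in> V"
    and star: "crossing ends E {v} = {e, a, b, c}" "distinct [e, a, b, c]"
    and IH: "\<And>E' ends' (w' :: 'e \<Rightarrow> real). quartic_graph (V - {v}) E' ends' \<Longrightarrow> e \<in> E' \<Longrightarrow>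
      \<exists>H \<subseteq> E' - {e}. two_edge_connected (V - {v}) ends' H \<and> sum w' H \<le> 2/3 * sum w' (E' - {e})"
    and split: "splittable V E ends v e a b c" "splittable V E ends v e b a c"
  shows "\<exists>H \<subseteq> E - {e}. two_edge_connected V ends H \<and> sum w H \<le> 2/3 * sum w (E - {e})"
proof -
  interpret quartic_graph V E ends by (rule G)
  have "\<exists>x. ends f = {v, x}" if "f \<in> {e, a, b, c}" for f
    using that star(1) ends_crossing_singleton by blast
  then obtain X A B C where
    endv: "ends e = {v, X}" "ends a = {v, A}" "ends b = {v, B}" "ends c = {v, C}"
    by (metis insertCI)
  define K where "K = E - {e, a, b, c}"
  have finK: "finite K" using finite_edges by (simp add: K_def)
  have lift: "\<exists>H \<subseteq> E - {e}. two_edge_connected V ends H \<and>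
      sum w H \<le> 2/3 * (sum w K + w c - w a) + w a + w b"
    if st: "crossing ends E {v} = {e, a, b, c}" "distinct [e, a, b, c]"
      and en: "ends e = {v, X}" "ends a = {v, A}" "ends b = {v, B}" "ends c = {v, C}"
      and K: "K = E - {e, a, b, c}"
      and sp: "splittable V E ends v e a b c" for a b c A B C
  proof -
    \<comment> \<open>With this weight the lift costs exactly \<open>w a + w b\<close> more than
      \<open>H\<close>, whether or not \<open>H\<close> uses the new edge.\<close>
    let ?w = "w(b := w c - w a)"
    note edges = star_edges[OF v st en]
    have "e \<in> E - {a, c}" using edges st(2) by auto
    then obtain H where H: "H \<subseteq> E - {a, c} - {e}"
        "two_edge_connected (V - {v}) (split_ends ends v e a b c) H"
        "sum ?w H \<le> 2/3 * sum ?w (E - {a, c} - {e})"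
      using IH[OF sp, of ?w] by blast
    let ?L = "if b \<in> H then insert c H else insert a (insert b H)"
    have finH: "finite H" using H(1) finite_edges finite_subset by blast
    have "E - {a, c} - {e} = insert b K" "b \<notin> K" using edges st(2) by (auto simp: K)
    then have "sum ?w (E - {a, c} - {e}) = w c - w a + sum ?w K"
      using finK by simp
    also have "sum ?w K = sum w K" using \<open>b \<notin> K\<close> by (intro sum.cong) auto
    finally have "sum ?w H \<le> 2/3 * (sum w K + w c - w a)" using H(3) by simp
    moreover have "sum w ?L = sum ?w H + w a + w b"
    proof -
      have "c \<notin> H" "a \<notin> H" using H(1) by auto
      show ?thesis
      proof (cases "b \<in> H")
        case True
        then have "sum ?w H = w c - w a + sum ?w (H - {b})" "sum w H = w b + sum w (H - {b})"
          using finH by (simp_all add: sum.remove)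
        moreover have "sum ?w (H - {b}) = sum w (H - {b})" by (intro sum.cong) auto
        ultimately show ?thesis using True finH \<open>c \<notin> H\<close> by simp
      next
        case False
        then have "sum ?w H = sum w H" by (intro sum.cong) auto
        then show ?thesis using False finH \<open>a \<notin> H\<close> st(2) by simp
      qed
    qed
    moreover have "two_edge_connected V ends ?L"
      by (rule two_edge_connected_lift[OF v st en H(1,2)])
    moreover have "?L \<subseteq> E - {e}" using H(1) edges st(2) by auto
    ultimately show ?thesis by (intro exI[of _ ?L]) auto
  qed
  obtain H1 where H1: "H1 \<subseteq> E - {e}" "two_edge_connected V ends H1"
      "sum w H1 \<le> 2/3 * (sum w K + w c - w a) + w a + w b"
    using lift[OF star endv K_def split(1)] by blast
  have "crossing ends E {v} = {e, b, a, c}" "distinct [e, b, a, c]" "K = E - {e, b, a, c}"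
    using star K_def by auto
  then obtain H2 where H2: "H2 \<subseteq> E - {e}" "two_edge_connected V ends H2"
      "sum w H2 \<le> 2/3 * (sum w K + w c - w b) + w b + w a"
    using lift[OF _ _ endv(1,3,2,4) _ split(2)] by blast
  have "E - {e} = insert a (insert b (insert c K))" "a \<notin> insert b (insert c K)"
      "b \<notin> insert c K" "c \<notin> K"
    using star_edges[OF v star endv] star(2) by (auto simp: K_def)
  then have "sum w (E - {e}) = w a + w b + w c + sum w K"
    using finK by simp
  \<comment> \<open>The two bounds average to exactly \<open>2/3 * sum w (E - {e})\<close>, so at
    least one of them does not exceed it.\<close>
  then have "sum w H1 \<le> 2/3 * sum w (E - {e}) \<or> sum w H2 \<le> 2/3 * sum w (E - {e})"
    using H1(3) H2(3) by (simp add: algebra_simps) linarith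
  then show ?thesis using H1 H2 by blast
qed

lemma quartic_graph_two_edge_connected_subgraph:
  fixes w :: "'e \<Rightarrow> real"
  assumes "quartic_graph V E ends" "2 \<le> card V" "e \<in> E"
  shows "\<exists>H \<subseteq> E - {e}. two_edge_connected V ends H \<and> sum w H \<le> 2/3 * sum w (E - {e})"
  using assms
proof (induction "card V" arbitrary: V E ends w rule: less_induct)
  case less
  interpret quartic_graph V E ends by (rule less.prems)
  show ?case
  proof (cases "card V = 2")
    \<comment> \<open>On two vertices there are four parallel edges. Besides \<open>e\<close>, the
      heaviest of the other three is dropped; it weighs at least a third of their sum, whatever the
      signs.\<close>
    case True
    have ends_V: "ends f = V" if "f \<in> E" for f
      using ends_subset[OF that] card_ends[OF that] True finite_vertices
      by (simp add: card_subset_eq)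
    have crossing_eq: "crossing ends F S = F" if F: "F \<subseteq> E" and S: "S \<noteq> {}" "S \<subset> V" for F S
    proof -
      have "ends f = V" if "f \<in> F" for f using that F ends_V by blast
      moreover have "V \<inter> S \<noteq> {}" "\<not> V \<subseteq> S" using S by auto
      ultimately show ?thesis by (auto simp: crossing_def)
    qed
    obtain v where "v \<in> V" "{v} \<subset> V" using True by (auto simp: card_2_iff)
    then have "card E = 4" using degree[of v] crossing_eq[of E "{v}"] by simp
    then have card3: "card (E - {e}) = 3" using less.prems(3) by simp
    then have "E - {e} \<noteq> {}" by (metis card.empty zero_neq_numeral)
    then have "Max (w ` (E - {e})) \<in> w ` (E - {e})" using finite_edges by (intro Max_in) auto
    then obtain m where m: "m \<in> E - {e}" "w m = Max (w ` (E - {e}))" by (metis imageE)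
    have "w f \<le> w m" if "f \<in> E - {e}" for f
      unfolding m(2) using that finite_edges by (intro Max_ge) auto
    then have "sum w (E - {e}) \<le> 3 * w m"
      using sum_bounded_above[of "E - {e}" w "w m"] card3 by simp
    moreover have "sum w (E - {e}) = w m + sum w (E - {e} - {m})"
      using m(1) finite_edges by (intro sum.remove) auto
    moreover have "two_edge_connected V ends (E - {e} - {m})"
      unfolding two_edge_connected_def
    proof (intro allI impI)
      fix S assume "S \<noteq> {}" "S \<subset> V"
      then have "crossing ends (E - {e} - {m}) S = E - {e} - {m}"
        by (intro crossing_eq) auto
      moreover have "card (E - {e} - {m}) = 2" using card3 m(1) by (simp add: card_Diff_singleton)
      ultimately show "2 \<le> card (crossing ends (E - {e} - {m}) S)" by simp
    qed
    ultimately show ?thesis by (intro exI[of _ "E - {e} - {m}"]) auto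
  next
    case False
    then have card_V: "3 \<le> card V" using less.prems(2) by simp
    obtain v x where vx: "ends e = {v, x}" "v \<noteq> x" "v \<in> V" using ends_cases[OF less.prems(3)] .
    then have e: "e \<in> crossing ends E {v}" using less.prems(3) by (auto simp: crossing_def)
    then have "card (crossing ends E {v} - {e}) = 3"
      using degree[OF vx(3)] by simp
    then obtain a b c where abc: "crossing ends E {v} - {e} = {a, b, c}" "distinct [a, b, c]"
      by (auto simp: card_3_iff)
    have star: "crossing ends E {v} = {e, a, b, c}" using abc(1) e by blast
    have dist: "distinct [e, a, b, c]" using abc by auto
    have smaller: "card (V - {v}) < card V" "2 \<le> card (V - {v})"
      using card_V vx(3) finite_vertices by (auto simp: card_Diff1_less)
    have IH: "\<exists>H \<subseteq> E' - {e}. two_edge_connected (V - {v}) ends' H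
        \<and> sum w' H \<le> 2/3 * sum w' (E' - {e})"
      if "quartic_graph (V - {v}) E' ends'" "e \<in> E'" for E' ends' and w' :: "'e \<Rightarrow> real"
      by (rule less.hyps[OF smaller(1) that(1) smaller(2) that(2)])
    have star': "crossing ends E {v} = {e, a, c, b}" "distinct [e, a, c, b]"
      "crossing ends E {v} = {e, b, c, a}" "distinct [e, b, c, a]"
      using star dist by auto
    note or = splittable_or_splittable[OF card_V vx(3)]
    note step = quartic_graph_split_step[OF less.prems(1) vx(3) _ _ IH, of _ _ _ w]
    \<comment> \<open>Of any two pairings at least one is splittable, so at most one of the three
      fails. The cases list the two that remain, named as the step requires.\<close>
    consider "splittable V E ends v e a b c" "splittable V E ends v e b a c"
      | "splittable V E ends v e a c b" "splittable V E ends v e c a b"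
      | "splittable V E ends v e b c a" "splittable V E ends v e c b a"
      using or[OF star dist] or[OF star'(1,2)] or[OF star'(3,4)] by blast
    then show ?thesis
    proof cases
      case 1
      then show ?thesis using step[OF star dist] by blast
    next
      case 2
      then show ?thesis using step[OF star'(1,2)] by blast
    next
      case 3
      then show ?thesis using step[OF star'(3,4)] by blast
    qed
  qed
qed

section \<open>Multigraphs of edge copies and edge vectors\<close>

lemma Sigma_crossing_fst:
  assumes "H \<subseteq> complete_edges V \<times> UNIV" "S \<subseteq> V"
  shows "crossing fst H S = Sigma (cut V S) (\<lambda>f. H `` {f})"
proof -
  have "f \<inter> S \<noteq> {} \<and> \<not> f \<subseteq> S \<longleftrightarrow> card (f \<inter> S) = 1" if f: "f \<in> complete_edges V" for f
  proof -
    obtain x y where "f = {x, y}" "x \<noteq> y"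
      using f by (auto simp: complete_edges_def card_2_iff)
    then show ?thesis by (cases "x \<in> S"; cases "y \<in> S") auto
  qed
  then show ?thesis using assms by (fastforce simp: crossing_def cut_def)
qed

text \<open>A pair \<open>(f, i)\<close> is the copy number \<open>i\<close> of the edge
  \<open>f\<close>, with end map \<open>fst\<close>; the image of \<open>{f}\<close> under
  \<open>H\<close> has the multiplicity of \<open>f\<close> as its size. This links cuts of
  multigraphs to the constraints of the linear programs.\<close>

lemma card_crossing_fst:
  assumes "finite V" "finite H" "H \<subseteq> complete_edges V \<times> UNIV" "S \<subseteq> V"
  shows "card (crossing fst H S) = (\<Sum>f\<in>cut V S. card (H `` {f}))"
proof -
  have "finite (cut V S)" using assms(1) by (auto simp: cut_def complete_edges_def)
  moreover have "finite (H `` {f})" for f using assms(2) by (simp add: finite_Image)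
  ultimately show ?thesis
    unfolding Sigma_crossing_fst[OF assms(3,4)] by (simp add: card_SigmaI)
qed

lemma objective_multiplicity:
  assumes "finite V" "finite H" "H \<subseteq> complete_edges V \<times> UNIV"
  shows "objective V c (\<lambda>f. real (card (H `` {f}))) = (\<Sum>h\<in>H. c (fst h))"
proof -
  have fin: "finite (complete_edges V)" using assms(1) by (simp add: complete_edges_def)
  have "H = Sigma (complete_edges V) (\<lambda>f. H `` {f})" using assms(3) by auto
  then have "(\<Sum>h\<in>H. c (fst h)) = (\<Sum>h\<in>Sigma (complete_edges V) (\<lambda>f. H `` {f}). c (fst h))"
    by simp
  also have "\<dots> = (\<Sum>f\<in>complete_edges V. \<Sum>i\<in>H `` {f}. c f)"
    using fin assms(2) by (subst sum.Sigma) (auto simp: finite_Image split_def)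
  finally show ?thesis by (simp add: objective_def mult.commute)
qed

text \<open>Doubling \<open>x\<close> turns the degree and cut bounds of 2 into 4. The subgraph
  costs at most 2/3 of a multigraph that costs twice the objective of \<open>x\<close>.\<close>

lemma two_ecm_ip_four_thirds:
  assumes fin: "finite V" and card_V: "2 \<le> card V"
    and cost: "\<And>e. e \<in> complete_edges V \<Longrightarrow> 0 \<le> c e"
    and x: "x \<in> two_ecm_lp V" "half_integral V x"
  shows "\<exists>y \<in> two_ecm_ip V. objective V c y \<le> 4/3 * objective V c x"
proof -
  \<comment> \<open>By half-integrality \<open>2 * x f\<close> is 0, 1 or 2, so the floor is
    exact.\<close>
  define E where "E = Sigma (complete_edges V) (\<lambda>f. {..<nat \<lfloor>2 * x f\<rfloor>})"
  have finE: "finite E" using fin by (auto simp: E_def complete_edges_def)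
  have E_sub: "E \<subseteq> complete_edges V \<times> UNIV" by (auto simp: E_def)
  have mult: "real (card (E `` {f})) = 2 * x f" if "f \<in> complete_edges V" for f
  proof -
    have "E `` {f} = {..<nat \<lfloor>2 * x f\<rfloor>}" using that by (auto simp: E_def)
    then have card: "card (E `` {f}) = nat \<lfloor>2 * x f\<rfloor>" by simp
    have "2 * x f \<in> {0, 1, 2}" using x(2) that by (auto simp: half_integral_def)
    moreover have "real (nat \<lfloor>z\<rfloor>) = z" if "z \<in> {0, 1, 2}" for z :: real using that by auto
    ultimately show ?thesis unfolding card by blast
  qed
  have cross: "real (card (crossing fst E S)) = 2 * sum x (cut V S)" if "S \<subseteq> V" for S
    using mult unfolding card_crossing_fst[OF fin finE E_sub that] of_nat_sum sum_distrib_left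
    by (intro sum.cong) (auto simp: cut_def)
  interpret quartic_graph V E fst
  proof
    fix e assume "e \<in> E"
    then show "fst e \<subseteq> V" "card (fst e) = 2" by (auto simp: E_def complete_edges_def)
  next
    fix v assume "v \<in> V"
    then show "card (crossing fst E {v}) = 4"
      using cross[of "{v}"] x(1) by (simp add: two_ecm_lp_def)
  next
    fix S assume "S \<noteq> {}" "S \<subset> V"
    then show "4 \<le> card (crossing fst E S)"
      using cross[of S] x(1) by (auto simp: two_ecm_lp_def)
  qed (use fin finE in auto)
  obtain v where v: "v \<in> V" using card_V by fastforce
  then have "crossing fst E {v} \<noteq> {}" using degree[OF v] by auto
  then obtain e where e: "e \<in> E" by (auto simp: crossing_def)
  obtain H where H: "H \<subseteq> E - {e}" "two_edge_connected V fst H"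
      "(\<Sum>h\<in>H. c (fst h)) \<le> 2/3 * (\<Sum>h\<in>E - {e}. c (fst h))"
    using quartic_graph_two_edge_connected_subgraph[OF quartic_graph_axioms card_V e,
        of "\<lambda>h. c (fst h)"] by blast
  have finH: "finite H" using H(1) finE finite_subset by blast
  have H_sub: "H \<subseteq> complete_edges V \<times> UNIV" using H(1) E_sub by blast
  let ?y = "\<lambda>f. real (card (H `` {f}))"
  have "?y \<in> two_ecm_ip V"
    unfolding two_ecm_ip_def
  proof (intro CollectI conjI allI ballI impI)
    have "H `` {f} = {}" if "f \<notin> complete_edges V" for f using that H_sub by auto
    then show "?y \<in> edge_vectors V" by (simp add: edge_vectors_def)
  next
    fix S assume S: "S \<noteq> {} \<and> S \<subset> V"
    then have "2 \<le> card (crossing fst H S)" using H(2) by (auto simp: two_edge_connected_def)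
    also have "card (crossing fst H S) = (\<Sum>f\<in>cut V S. card (H `` {f}))"
      using S by (intro card_crossing_fst[OF fin finH H_sub]) auto
    finally show "2 \<le> sum ?y (cut V S)" by (simp flip: of_nat_sum)
  qed auto
  moreover have "objective V c ?y \<le> 4/3 * objective V c x"
  proof -
    have "objective V c ?y \<le> 2/3 * (\<Sum>h\<in>E - {e}. c (fst h))"
      using H(3) objective_multiplicity[OF fin finH H_sub] by simp
    \<comment> \<open>Nonnegativity of the costs allows \<open>e\<close> to be put back.\<close>
    also have "(\<Sum>h\<in>E - {e}. c (fst h)) \<le> (\<Sum>h\<in>E. c (fst h))"
      using finE E_sub by (intro sum_mono2) (auto intro!: cost)
    also have "\<dots> = objective V c (\<lambda>f. real (card (E `` {f})))"
      using objective_multiplicity[OF fin finE E_sub] by simp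
    also have "\<dots> = 2 * objective V c x"
      unfolding objective_def sum_distrib_left by (intro sum.cong) (auto simp: mult)
    finally show ?thesis by simp
  qed
  ultimately show ?thesis by blast
qed

section \<open>Hamiltonian cycles and the integrality gap\<close>

lemma hamiltonian_cycle_card_ge_3: "hamiltonian_cycle V T \<Longrightarrow> 3 \<le> card V"
  by (auto simp: hamiltonian_cycle_def distinct_card)

lemma hamiltonian_cycle_degree_le_2:
  assumes "hamiltonian_cycle V T" "v \<in> V"
  shows "card {e \<in> T. v \<in> e} \<le> 2"
proof -
  obtain vs where vs: "distinct vs" "set vs = V" "length vs \<ge> 3"
      "T = {{vs ! i, vs ! (Suc i mod length vs)} | i. i < length vs}"
    using assms(1) by (auto simp: hamiltonian_cycle_def)
  let ?n = "length vs"
  obtain j where j: "j < ?n" "vs ! j = v" using assms(2) vs(2) by (metis in_set_conv_nth)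
  \<comment> \<open>The cyclic predecessor of \<open>j\<close>; only the edges starting at positions
    \<open>j\<close> and \<open>?k\<close> contain \<open>v\<close>.\<close>
  let ?k = "if j = 0 then ?n - 1 else j - 1"
  let ?edge = "\<lambda>i. {vs ! i, vs ! (Suc i mod ?n)}"
  have "{e \<in> T. v \<in> e} \<subseteq> {?edge j, ?edge ?k}"
  proof
    fix e assume "e \<in> {e \<in> T. v \<in> e}"
    then obtain i where i: "i < ?n" "e = ?edge i" "v \<in> ?edge i" using vs(4) by auto
    have "0 < ?n" using i(1) by linarith
    then have "Suc i mod ?n < ?n" by (rule mod_less_divisor)
    then have "i = j \<or> Suc i mod ?n = j"
      using i j vs(1) by (auto simp: nth_eq_iff_index_eq)
    then have "i = j \<or> i = ?k"
      using i(1) by (cases "Suc i = ?n") auto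
    then show "e \<in> {?edge j, ?edge ?k}" using i(2) by blast
  qed
  then have "card {e \<in> T. v \<in> e} \<le> card {?edge j, ?edge ?k}" by (intro card_mono) auto
  also have "\<dots> \<le> 2" by (simp add: card_insert_if)
  finally show ?thesis .
qed

lemma sum_indicator:
  "finite A \<Longrightarrow> sum (indicator B) A = (of_nat (card (A \<inter> B)) :: 'b :: semiring_1)"
  by (subst sum.cong[OF refl, of _ _ "\<lambda>x. of_bool (x \<in> B)"]) simp_all

theorem corollary2p10:
  fixes V :: "'a set" and c :: "'a set \<Rightarrow> real" and T :: "'a set set"
  assumes "finite V"
    and "metric_costs V c"
    and "hamiltonian_cycle V T"
    and "\<And>x. optimal_solution V c (two_ecm_ip V) x \<longleftrightarrow> x = indicator T"
    and "\<exists>x. optimal_solution V c (two_ecm_lp V) x \<and> half_integral V x"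
  shows "opt_value V c (tsp_ip V) \<le> 4/3 * opt_value V c (tsp_lp V)"
proof -
  note card_V = hamiltonian_cycle_card_ge_3[OF assms(3)]
  have cost: "0 \<le> c e" if "e \<in> complete_edges V" for e
    using assms(2) that by (simp add: metric_costs_def)
  have fin: "finite (complete_edges V)" using assms(1) by (simp add: complete_edges_def)
  have T_opt: "(indicator T :: 'a set \<Rightarrow> real) \<in> two_ecm_ip V"
      "\<And>y. y \<in> two_ecm_ip V \<Longrightarrow> objective V c (indicator T) \<le> objective V c y"
    using assms(4)[of "indicator T"]
    by (auto simp: optimal_solution_def is_arg_min_linorder)
  obtain x where x: "x \<in> two_ecm_lp V" "half_integral V x"
      "\<And>z. z \<in> two_ecm_lp V \<Longrightarrow> objective V c x \<le> objective V c z"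
    using assms(5) by (auto simp: optimal_solution_def is_arg_min_linorder)
  obtain y where y: "y \<in> two_ecm_ip V" "objective V c y \<le> 4/3 * objective V c x"
    using two_ecm_ip_four_thirds[where c = c, OF assms(1) _ cost x(1,2)] card_V by auto
  \<comment> \<open>The cycle is cheapest among all 2-edge-connected multisubgraphs, hence no dearer
    than \<open>y\<close>.\<close>
  have T_le: "objective V c (indicator T) \<le> 4/3 * objective V c x"
    using T_opt(2)[OF y(1)] y(2) by linarith
  \<comment> \<open>This makes \<open>tsp_lp V\<close> nonempty, so that its infimum is meaningful.
    At each vertex the cycle gives degree at most 2 and the cut constraint of
    \<open>two_ecm_ip\<close> at least 2.\<close>
  have T_lp: "indicator T \<in> tsp_lp V"
  proof -
    have "sum (indicator T) (cut V {v}) = (2 :: real)" if v: "v \<in> V" for v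
    proof (rule antisym)
      have "cut V {v} \<inter> T \<subseteq> {e \<in> T. v \<in> e}"
        by (auto simp: cut_def Int_insert_right split: if_splits)
      moreover have "finite T" using assms(3) by (auto simp: hamiltonian_cycle_def)
      ultimately have "card (cut V {v} \<inter> T) \<le> card {e \<in> T. v \<in> e}"
        by (intro card_mono) auto
      also have "\<dots> \<le> 2" by (rule hamiltonian_cycle_degree_le_2[OF assms(3) v])
      finally have "card (cut V {v} \<inter> T) \<le> 2" .
      moreover have "finite (cut V {v})" using fin by (simp add: cut_def)
      ultimately show "sum (indicator T) (cut V {v}) \<le> (2 :: real)"
        by (simp add: sum_indicator)
      have "{v} \<noteq> V" using card_V by auto
      then show "(2 :: real) \<le> sum (indicator T) (cut V {v})"
        using T_opt(1) v by (auto simp: two_ecm_ip_def)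
    qed
    then show ?thesis
      using T_opt(1) by (auto simp: tsp_lp_def two_ecm_ip_def indicator_def)
  qed
  have "opt_value V c (tsp_ip V) \<le> objective V c (indicator T)"
    unfolding opt_value_def
  proof (rule cINF_lower)
    show "bdd_below (objective V c ` tsp_ip V)"
      unfolding objective_def tsp_ip_def
      by (intro bdd_belowI[of _ 0]) (auto intro!: sum_nonneg mult_nonneg_nonneg cost)
    show "indicator T \<in> tsp_ip V" using assms(3) by (auto simp: tsp_ip_def)
  qed
  also have "\<dots> \<le> 4/3 * objective V c x" by (rule T_le)
  \<comment> \<open>\<open>tsp_lp V\<close> is \<open>two_ecm_lp V\<close> with upper bounds added,
    so the optimum \<open>x\<close> of the larger set bounds it from below.\<close>
  also have "objective V c x \<le> opt_value V c (tsp_lp V)"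
    unfolding opt_value_def
  proof (rule cINF_greatest)
    show "tsp_lp V \<noteq> {}" using T_lp by blast
    show "objective V c x \<le> objective V c z" if "z \<in> tsp_lp V" for z
      using x(3)[of z] that by (auto simp: tsp_lp_def two_ecm_lp_def)
  qed
  finally show ?thesis by simp
qed

end
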